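(* Let $\Sigma$ be a finite nonempty set of $d\times d$ real matrices with nonnegative entries. There exists a constant $K>0$ such that the following holds. For each $i\in\{1,\dots,d\}$ let $m_i$ be any positive integer with $\|\Sigma^{m_i}\|_{i,i}\ne 0$, or $m_i=1$ if no such positive integer exists. Then \[ \max_{i}\sqrt[m_i]{\|\Sigma^{m_i}\|_{i,i}}\;\le\;\rho(\Sigma)\;\le\;\max_i\sqrt[m_i]{K\,\|\Sigma^{m_i}\|_{i,i}}. \]
   Context: For $n\ge1$, $\|\Sigma^n\|_{i,j}=\max_{A_1,\dots,A_n\in\Sigma}(A_1\cdots A_n)_{i,j}$. The joint spectral radius is $\rho(\Sigma)=\lim_{n\to\infty}\sqrt[n]{\max_{A_1,\dots,A_n\in\Sigma}\|A_1\cdots A_n\|}$ for any matrix norm (the limit exists and is independent of the norm). The constant $K$ depends only on $\Sigma$, not on the choice of the $m_i$. *)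

theory Defs
  imports "HOL-Analysis.Analysis"
begin

text \<open>Products A_1 ** ... ** A_n of length n with all factors in S (n = 0 gives the identity).\<close>
definition prods :: "(real^'n^'n) set \<Rightarrow> nat \<Rightarrow> (real^'n^'n) set" where
  "prods S n = {foldr (**) As (mat 1) | As. length As = n \<and> set As \<subseteq> S}"

text \<open>Entrywise maximum over products of length n: the (i,j) entry of the "norm" of S^n.\<close>
definition pnorm :: "(real^'n^'n) set \<Rightarrow> nat \<Rightarrow> 'n \<Rightarrow> 'n \<Rightarrow> real" where
  "pnorm S n i j = Max ((\<lambda>P. P $ i $ j) ` prods S n)"

text \<open>Joint spectral radius, as the limit of n-th roots of the maximal norm of length-n
  products (using the Frobenius norm of real^'n^'n; the limit is norm-independent).\<close>
definition jsr :: "(real^'n^'n) set \<Rightarrow> real" where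
  "jsr S = lim (\<lambda>n. root n (Max (norm ` prods S n)))"

end

theory Submission
  imports Defs
begin

text \<open>
  Write \<open>\<rho>\<close> for the joint spectral radius and \<open>d\<close> for the dimension. The largest entry of a
  product of length \<open>n\<close>, multiplied by \<open>d\<close>, is submultiplicative in \<open>n\<close> and comparable to the
  largest norm, so by Fekete's lemma its \<open>n\<close>-th root tends to \<open>\<rho>\<close>. Diagonal entries are
  supermultiplicative, hence \<open>root m \<parallel>\<Sigma>\<^sup>m\<parallel>\<^sub>i\<^sub>i \<le> \<rho>\<close>, which is the lower bound.

  For the upper bound, cut a product of length \<open>(d + 1) N\<close> into \<open>d + 1\<close> blocks of length \<open>N\<close>
  and follow a heaviest chain of indices through the block boundaries: by pigeonhole it contains
  a cycle, so the growth rate of some diagonal entry \<open>(i, i)\<close> is at least \<open>\<rho>\<close>. For such an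
  \<open>i\<close>, a return time \<open>n\<close> (a length with \<open>\<parallel>\<Sigma>\<^sup>n\<parallel>\<^sub>i\<^sub>i > 0\<close>) is realised by walking from \<open>i\<close>
  into its strongly connected class, following an entry of length \<open>n - X\<close> of size about
  \<open>\<rho>\<^sup>n\<^sup>-\<^sup>X\<close>, walking back to \<open>i\<close> and padding with a return of bounded length. The padding
  exists because the return times are closed under addition and therefore contain all large
  multiples of their greatest common divisor. This gives \<open>\<rho>\<^sup>n \<le> K \<parallel>\<Sigma>\<^sup>n\<parallel>\<^sub>i\<^sub>i\<close> for all
  return times \<open>n\<close>.
\<close>

section \<open>Growth rates of submultiplicative sequences\<close>

locale submultiplicative_seq =
  fixes f :: "nat \<Rightarrow> real"
  assumes nonneg: "0 \<le> f n"
    and submult: "f (a + b) \<le> f a * f b"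
begin

definition growth_rate :: real where
  "growth_rate = Inf {root n (f n) | n. 0 < n}"

lemma le_pow_mult_add: "f (q * k + r) \<le> f k ^ q * f r"
proof (induction q)
  case (Suc q)
  have "f (Suc q * k + r) = f (k + (q * k + r))" by (simp add: algebra_simps)
  also have "\<dots> \<le> f k * f (q * k + r)" by (rule submult)
  also have "\<dots> \<le> f k * (f k ^ q * f r)" using Suc nonneg by (intro mult_left_mono) auto
  finally show ?case by (simp add: algebra_simps)
qed simp

lemma exp_bound_if_le_pow:
  assumes k: "0 < k" "f k \<le> y ^ k" and y: "0 < y"
  shows "\<exists>C>0. \<forall>n. f n \<le> C * y ^ n"
proof -
  define C0 where "C0 = Max (f ` {..<k})"
  define C where "C = (C0 + 1) * max 1 (1 / y) ^ k"
  have C0: "f r \<le> C0" if "r < k" for r unfolding C0_def using that by (intro Max_ge) auto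
  have "0 \<le> C0" using C0[OF k(1)] nonneg by (meson order_trans)
  have "f n \<le> C * y ^ n" for n
  proof -
    define q r where "q = n div k" and "r = n mod k"
    have n: "n = q * k + r" and r: "r < k" unfolding q_def r_def using k by simp_all
    have "f n \<le> f k ^ q * f r" unfolding n by (rule le_pow_mult_add)
    also have "\<dots> \<le> (y ^ k) ^ q * C0"
      using k y nonneg C0[OF r] by (intro mult_mono power_mono) auto
    also have "(y ^ k) ^ q = y ^ n * (1 / y) ^ r"
      using y unfolding n by (simp add: power_add power_mult power_divide mult.commute)
    also have "(1 / y) ^ r \<le> max 1 (1 / y) ^ k"
      using r y by (intro order_trans[OF power_mono power_increasing]) auto
    then have "y ^ n * (1 / y) ^ r * C0 \<le> y ^ n * max 1 (1 / y) ^ k * (C0 + 1)"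
      using y \<open>0 \<le> C0\<close> by (intro mult_mono) auto
    finally show ?thesis unfolding C_def by (simp add: algebra_simps)
  qed
  moreover have "0 < C" unfolding C_def using \<open>0 \<le> C0\<close> by simp
  ultimately show ?thesis by blast
qed

lemma growth_rate_le_root: "0 < n \<Longrightarrow> growth_rate \<le> root n (f n)"
  unfolding growth_rate_def
  by (rule cInf_lower) (auto intro!: bdd_belowI[of _ 0] simp: nonneg)

lemma growth_rate_nonneg: "0 \<le> growth_rate"
  unfolding growth_rate_def by (rule cInf_greatest) (auto simp: nonneg)

lemma growth_rate_pow_le: "0 < n \<Longrightarrow> growth_rate ^ n \<le> f n"
  using power_mono[OF growth_rate_le_root growth_rate_nonneg, of n n] nonneg
  by simp

lemma exp_bound_above_growth_rate:
  assumes "growth_rate < y"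
  shows "\<exists>C>0. \<forall>n. f n \<le> C * y ^ n"
proof -
  obtain k where k: "0 < k" "root k (f k) < y"
    using cInf_lessD[of "{root n (f n) | n. 0 < n}" y] assms unfolding growth_rate_def by auto
  have "f k = root k (f k) ^ k" using k nonneg by simp
  also have "\<dots> \<le> y ^ k" using k nonneg by (intro power_mono) auto
  finally show ?thesis
    using exp_bound_if_le_pow[OF k(1)] assms growth_rate_nonneg by auto
qed

lemma root_tendsto_growth_rate: "(\<lambda>n. root n (f n)) \<longlonglongrightarrow> growth_rate"
proof (rule order_tendstoI)
  fix a assume a: "a < growth_rate"
  show "\<forall>\<^sub>F n in sequentially. a < root n (f n)"
    using eventually_gt_at_top[of 0]
    by eventually_elim (use a growth_rate_le_root in \<open>auto intro: less_le_trans\<close>)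
next
  fix a assume "growth_rate < a"
  define y where "y = (growth_rate + a) / 2"
  have y: "growth_rate < y" "y < a" using \<open>growth_rate < a\<close> unfolding y_def by auto
  obtain C where C: "0 < C" "\<And>n. f n \<le> C * y ^ n"
    using exp_bound_above_growth_rate[OF y(1)] by blast
  have "(\<lambda>n. root n C * y) \<longlonglongrightarrow> 1 * y"
    by (intro tendsto_mult_right LIMSEQ_root_const C)
  then have "\<forall>\<^sub>F n in sequentially. root n C * y < a" using y by (intro order_tendstoD(2)) auto
  then show "\<forall>\<^sub>F n in sequentially. root n (f n) < a"
    using eventually_gt_at_top[of 0]
  proof eventually_elim
    case (elim n)
    have "root n (f n) \<le> root n (C * y ^ n)" using C elim by (intro real_root_le_mono) auto
    also have "\<dots> = root n C * y"
      using elim y growth_rate_nonneg by (simp add: real_root_mult real_root_power_cancel)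
    finally show ?case using elim by simp
  qed
qed

end

lemma root_tendsto_squeeze:
  fixes f g :: "nat \<Rightarrow> real"
  assumes lim: "(\<lambda>n. root n (f n)) \<longlonglongrightarrow> L" and "0 < a" "0 < b"
    and lower: "\<And>n. a * f n \<le> g n" and upper: "\<And>n. g n \<le> b * f n"
  shows "(\<lambda>n. root n (g n)) \<longlonglongrightarrow> L"
proof (rule tendsto_sandwich)
  show "(\<lambda>n. root n a * root n (f n)) \<longlonglongrightarrow> L"
    using tendsto_mult[OF LIMSEQ_root_const[OF \<open>0 < a\<close>] lim] by simp
  show "(\<lambda>n. root n b * root n (f n)) \<longlonglongrightarrow> L"
    using tendsto_mult[OF LIMSEQ_root_const[OF \<open>0 < b\<close>] lim] by simp
  show "\<forall>\<^sub>F n in sequentially. root n a * root n (f n) \<le> root n (g n)"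
    using eventually_gt_at_top[of 0]
    by eventually_elim (simp add: real_root_mult[symmetric] real_root_le_mono lower)
  show "\<forall>\<^sub>F n in sequentially. root n (g n) \<le> root n b * root n (f n)"
    using eventually_gt_at_top[of 0]
    by eventually_elim (simp add: real_root_mult[symmetric] real_root_le_mono upper)
qed

section \<open>Elementary estimates\<close>

lemma le_if_pow_le_const_mult_pow:
  fixes a b D :: real
  assumes "0 \<le> b" and le: "\<And>N. 0 < N \<Longrightarrow> a ^ N \<le> D * b ^ N"
  shows "a \<le> b"
proof (rule ccontr)
  assume "\<not> a \<le> b"
  then have "b < a" by simp
  show False
  proof (cases "b = 0")
    case True
    then show False using le[of 1] \<open>b < a\<close> by simp
  next
    case False
    then have "1 < a / b" using \<open>0 \<le> b\<close> \<open>b < a\<close> by simp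
    then obtain N where "D < (a / b) ^ N" using real_arch_pow by blast
    also have "\<dots> \<le> (a / b) ^ Suc N" using \<open>1 < a / b\<close> by (intro power_increasing) auto
    finally have "D * b ^ Suc N < a ^ Suc N"
      using False \<open>0 \<le> b\<close> by (simp add: field_simps)
    then show False using le[of "Suc N"] by simp
  qed
qed

lemma root_le_root_if_pow_le:
  fixes x X :: real
  assumes "0 < n" "0 < N" "0 \<le> x" "0 \<le> X" "x ^ N \<le> X ^ n"
  shows "root n x \<le> root N X"
proof -
  have "root n x ^ (n * N) = x ^ N"
    by (simp only: power_mult real_root_pow_pos2[OF assms(1,3)])
  moreover have "root N X ^ (n * N) = X ^ n"
    by (simp only: mult.commute[of n N] power_mult real_root_pow_pos2[OF assms(2,4)])
  moreover have "n * N = Suc (n * N - 1)" using assms(1,2) by simp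
  ultimately have "root n x ^ Suc (n * N - 1) \<le> root N X ^ Suc (n * N - 1)"
    using assms(5) by (simp only:)
  then show ?thesis by (rule power_le_imp_le_base) (rule real_root_ge_zero[OF assms(4)])
qed

lemma pow_mult_pow_le_geometric:
  fixes E R y C :: real
  assumes q: "1 \<le> q" "q \<le> d" and R: "0 \<le> R" "R \<le> y"
    and E: "0 \<le> E" "E \<le> C * y ^ N" and "1 \<le> C"
  shows "E ^ (Suc d - q) * R ^ (q * N) \<le> C ^ Suc d * (y ^ d * R) ^ N"
proof -
  have "0 \<le> y" using R by linarith
  have "E ^ (Suc d - q) \<le> (C * y ^ N) ^ (Suc d - q)" using E by (intro power_mono)
  also have "\<dots> \<le> C ^ Suc d * (y ^ N) ^ (Suc d - q)"
    unfolding power_mult_distrib using \<open>0 \<le> y\<close> \<open>1 \<le> C\<close>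
    by (intro mult_right_mono power_increasing) auto
  finally have blocks: "E ^ (Suc d - q) \<le> C ^ Suc d * (y ^ N) ^ (Suc d - q)" .
  have "R ^ (q * N) = R ^ N * (R ^ N) ^ (q - 1)"
    using q(1) by (metis le_add_diff_inverse mult.commute power_add power_mult power_one_right)
  also have "\<dots> \<le> R ^ N * (y ^ N) ^ (q - 1)"
    using R by (intro mult_left_mono power_mono) auto
  finally have cycle: "R ^ (q * N) \<le> R ^ N * (y ^ N) ^ (q - 1)" .
  have "(y ^ N) ^ (Suc d - q) * (y ^ N) ^ (q - 1) = (y ^ N) ^ ((Suc d - q) + (q - 1))"
    by (rule power_add[symmetric])
  also have "(Suc d - q) + (q - 1) = d" using q by simp
  finally have powers: "(y ^ N) ^ (Suc d - q) * (y ^ N) ^ (q - 1) = (y ^ d) ^ N"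
    by (simp only: power_mult[symmetric] mult.commute)
  have "E ^ (Suc d - q) * R ^ (q * N) \<le> C ^ Suc d * (y ^ N) ^ (Suc d - q) * (R ^ N * (y ^ N) ^ (q - 1))"
    using blocks cycle E(1) R(1) \<open>0 \<le> y\<close> \<open>1 \<le> C\<close> by (intro mult_mono) auto
  also have "\<dots> = C ^ Suc d * (y ^ d * R) ^ N"
    unfolding power_mult_distrib powers[symmetric] by (simp only: mult_ac)
  finally show ?thesis .
qed

lemma finite_pos_lower_bound:
  fixes f :: "'a \<Rightarrow> real"
  assumes "finite A" "\<And>x. x \<in> A \<Longrightarrow> 0 < f x"
  obtains c where "0 < c" "\<And>x. x \<in> A \<Longrightarrow> c \<le> f x"
proof (cases "A = {}")
  case False
  show ?thesis
    by (rule that[of "Min (f ` A)"]) (use assms False in auto)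
qed (use that[of 1] in simp)

section \<open>Additively closed sets of natural numbers\<close>

lemma mult_mem_if_add_closed:
  fixes M :: "nat set"
  assumes add: "\<And>a b. a \<in> M \<Longrightarrow> b \<in> M \<Longrightarrow> a + b \<in> M" and "0 \<in> M" "a \<in> M"
  shows "q * a \<in> M"
  by (induction q) (use assms in auto)

lemma dvd_if_least_difference:
  fixes M :: "nat set"
  assumes add: "\<And>a b. a \<in> M \<Longrightarrow> b \<in> M \<Longrightarrow> a + b \<in> M" and "0 \<in> M"
    and xy: "x \<in> M" "y \<in> M" "x = y + g" "0 < g"
    and least: "\<And>a b. a \<in> M \<Longrightarrow> b \<in> M \<Longrightarrow> b < a \<Longrightarrow> g \<le> a - b"
    and "s \<in> M"
  shows "g dvd s"
proof -
  define q r where "q = s div g" and "r = s mod g"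
  have "s + q * y = q * x + r" unfolding q_def r_def xy(3) by (simp add: algebra_simps)
  moreover have "s + q * y \<in> M"
    by (intro add \<open>s \<in> M\<close> mult_mem_if_add_closed[OF add \<open>0 \<in> M\<close> xy(2)])
  moreover have "q * x \<in> M" by (rule mult_mem_if_add_closed[OF add \<open>0 \<in> M\<close> xy(1)])
  moreover have "r < g" unfolding r_def using \<open>0 < g\<close> by simp
  ultimately have "r = 0" using least[of "s + q * y" "q * x"] by linarith
  then show ?thesis unfolding r_def by auto
qed

lemma large_multiples_mem_if_add_closed:
  fixes M :: "nat set"
  assumes add: "\<And>a b. a \<in> M \<Longrightarrow> b \<in> M \<Longrightarrow> a + b \<in> M" and "0 \<in> M"
    and k: "0 < k" "0 < g" "k * g \<in> M" "k * g + g \<in> M"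
    and z: "k * k * g \<le> z" "g dvd z"
  shows "z \<in> M"
proof -
  obtain Q where Q: "z = Q * g" using z(2) by (metis dvd_def mult.commute)
  define m r where "m = Q div k" and "r = Q mod k"
  have "r < k" unfolding r_def using k by simp
  have "k * k \<le> Q" using z(1) Q k by simp
  then have "k \<le> m" unfolding m_def using k by (simp add: less_eq_div_iff_mult_less_eq)
  define m' where "m' = m - r"
  have "Q = (r + m') * k + r" unfolding m'_def using \<open>r < k\<close> \<open>k \<le> m\<close>
    by (simp add: m_def r_def)
  then have "z = m' * (k * g) + r * (k * g + g)" unfolding Q by (simp add: algebra_simps)
  then show ?thesis
    by (simp only:) (intro add mult_mem_if_add_closed[OF add \<open>0 \<in> M\<close>] k(3,4))
qed

lemma add_closed_least_gap:
  fixes M :: "nat set"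
  assumes add: "\<And>a b. a \<in> M \<Longrightarrow> b \<in> M \<Longrightarrow> a + b \<in> M" and "0 \<in> M" "t \<in> M" "0 < t"
  obtains g y where "0 < g" "y \<in> M" "y + g \<in> M" "\<And>s. s \<in> M \<Longrightarrow> g dvd s"
proof -
  define D where "D = {a - b | a b. a \<in> M \<and> b \<in> M \<and> b < a}"
  have "t \<in> D" unfolding D_def using assms by force
  define g where "g = (LEAST d. d \<in> D)"
  have least: "g \<le> a - b" if "a \<in> M" "b \<in> M" "b < a" for a b
    unfolding g_def by (rule Least_le) (use that D_def in blast)
  have "g \<in> D" unfolding g_def by (rule LeastI[of "\<lambda>d. d \<in> D"]) (rule \<open>t \<in> D\<close>)
  then obtain x y where "x \<in> M" "y \<in> M" "y < x" "g = x - y"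
    unfolding D_def by blast
  then have xy: "x \<in> M" "y \<in> M" "x = y + g" "0 < g" by simp_all
  show ?thesis
  proof (rule that[OF xy(4,2)])
    show "y + g \<in> M" using xy(1,3) by simp
    show "g dvd s" if "s \<in> M" for s
      by (rule dvd_if_least_difference[OF add \<open>0 \<in> M\<close> xy least that])
  qed
qed

lemma add_closed_eventually_periodic:
  fixes T :: "nat set"
  assumes add: "\<And>a b. a \<in> T \<Longrightarrow> b \<in> T \<Longrightarrow> a + b \<in> T" and "0 \<notin> T" "t \<in> T"
  obtains g F where "0 < g" "\<And>s. s \<in> T \<Longrightarrow> g dvd s" "\<And>z. F \<le> z \<Longrightarrow> g dvd z \<Longrightarrow> z \<in> T"
proof -
  define M where "M = insert 0 T"
  have addM: "a + b \<in> M" if "a \<in> M" "b \<in> M" for a b using that add unfolding M_def by auto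
  have "0 \<in> M" "t \<in> M" "0 < t" using assms unfolding M_def by (auto intro: gr0I)
  then obtain g y where gy: "0 < g" "y \<in> M" "y + g \<in> M" "\<And>s. s \<in> M \<Longrightarrow> g dvd s"
    using add_closed_least_gap[OF addM] by blast
  obtain k where k: "0 < k" "0 < g" "k * g \<in> M" "k * g + g \<in> M"
  proof (cases "y = 0")
    case True
    then show ?thesis using that[of 1] gy(1,3) addM[OF gy(3) gy(3)] by simp
  next
    case False
    obtain k where y: "y = k * g" using gy(4)[OF gy(2)] by (metis dvd_def mult.commute)
    show ?thesis
    proof (rule that[OF _ gy(1)])
      show "0 < k" using False y by simp
      show "k * g \<in> M" "k * g + g \<in> M" using gy(2,3) unfolding y .
    qed
  qed
  show ?thesis
  proof (rule that[OF \<open>0 < g\<close>])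
    show "g dvd s" if "s \<in> T" for s using gy(4) that unfolding M_def by simp
    show "z \<in> T" if "k * k * g \<le> z" "g dvd z" for z
    proof -
      have "z \<in> M" by (rule large_multiples_mem_if_add_closed[OF addM \<open>0 \<in> M\<close> k that])
      moreover have "0 < k * k * g" using k by simp
      ultimately show ?thesis using that(1) unfolding M_def by simp
    qed
  qed
qed

section \<open>Products of nonnegative matrices\<close>

lemma foldr_matrix_mult_append:
  fixes As Bs :: "('a::semiring_1^'n^'n) list"
  shows "foldr (**) (As @ Bs) (mat 1) = foldr (**) As (mat 1) ** foldr (**) Bs (mat 1)"
  by (induction As) (auto simp: matrix_mul_assoc)

definition entry_max :: "(real^'n^'n) set \<Rightarrow> nat \<Rightarrow> real" where
  "entry_max S n = Max (range (\<lambda>(j, k). pnorm S n j k))"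

definition diag_rate :: "(real^'n^'n) set \<Rightarrow> 'n \<Rightarrow> real" where
  "diag_rate S i = Sup {root n (pnorm S n i i) | n. 0 < n}"

definition reaches :: "(real^'n^'n) set \<Rightarrow> 'n \<Rightarrow> 'n \<Rightarrow> bool" where
  "reaches S j k \<longleftrightarrow> (\<exists>n. 0 < pnorm S n j k)"

definition scc :: "(real^'n^'n) set \<Rightarrow> 'n \<Rightarrow> 'n set" where
  "scc S i = {j. reaches S i j \<and> reaches S j i}"

definition scc_entry_max :: "(real^'n^'n) set \<Rightarrow> 'n \<Rightarrow> nat \<Rightarrow> real" where
  "scc_entry_max S i n = Max ((\<lambda>(j, k). pnorm S n j k) ` (scc S i \<times> scc S i))"

definition return_times :: "(real^'n^'n) set \<Rightarrow> 'n \<Rightarrow> nat set" where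
  "return_times S i = {n. 0 < n \<and> 0 < pnorm S n i i}"

locale nonneg_matrix_set =
  fixes S :: "(real^'n::finite^'n) set"
  assumes finite: "finite S" and nonempty: "S \<noteq> {}"
    and nonneg: "\<forall>A\<in>S. \<forall>i j. 0 \<le> A $ i $ j"
begin

lemma prods_finite: "finite (prods S n)"
proof -
  have "prods S n = (\<lambda>As. foldr (**) As (mat 1)) ` {As. set As \<subseteq> S \<and> length As = n}"
    unfolding prods_def by auto
  then show ?thesis using finite_lists_length_eq[OF finite] by simp
qed

lemma prods_nonempty: "prods S n \<noteq> {}"
proof -
  obtain A where "A \<in> S" using nonempty by auto
  then have "foldr (**) (replicate n A) (mat 1) \<in> prods S n"
    unfolding prods_def by (auto simp del: foldr_replicate)
  then show ?thesis by auto
qed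

lemma prods_0: "prods S 0 = {mat 1}"
  unfolding prods_def by auto

lemma prods_add: "P \<in> prods S a \<Longrightarrow> Q \<in> prods S b \<Longrightarrow> P ** Q \<in> prods S (a + b)"
  unfolding prods_def
proof clarify
  fix As Bs assume "set As \<subseteq> S" "set Bs \<subseteq> S"
  then show "\<exists>Cs. foldr (**) As (mat 1) ** foldr (**) Bs (mat 1) = foldr (**) Cs (mat 1) \<and>
      length Cs = length As + length Bs \<and> set Cs \<subseteq> S"
    by (intro exI[of _ "As @ Bs"]) (auto simp: foldr_matrix_mult_append simp del: foldr_append)
qed

lemma prods_add_split:
  assumes "X \<in> prods S (a + b)"
  obtains P Q where "P \<in> prods S a" "Q \<in> prods S b" "X = P ** Q"
proof -
  obtain Cs where Cs: "X = foldr (**) Cs (mat 1)" "length Cs = a + b" "set Cs \<subseteq> S"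
    using assms unfolding prods_def by auto
  have "X = foldr (**) (take a Cs) (mat 1) ** foldr (**) (drop a Cs) (mat 1)"
    using Cs(1) foldr_matrix_mult_append[of "take a Cs" "drop a Cs"] by simp
  moreover have "foldr (**) (take a Cs) (mat 1) \<in> prods S a"
    unfolding prods_def using Cs set_take_subset[of a Cs] by (intro CollectI exI[of _ "take a Cs"]) auto
  moreover have "foldr (**) (drop a Cs) (mat 1) \<in> prods S b"
    unfolding prods_def using Cs set_drop_subset[of a Cs] by (intro CollectI exI[of _ "drop a Cs"]) auto
  ultimately show ?thesis using that by blast
qed

lemma prods_nonneg: "P \<in> prods S n \<Longrightarrow> 0 \<le> P $ i $ j"
proof -
  assume "P \<in> prods S n"
  then obtain As where As: "P = foldr (**) As (mat 1)" "set As \<subseteq> S" unfolding prods_def by auto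
  have "\<forall>i j. 0 \<le> foldr (**) As (mat 1) $ i $ j" using As(2)
    by (induction As) (auto simp: mat_def matrix_matrix_mult_def nonneg intro!: sum_nonneg)
  then show ?thesis using As by auto
qed

lemma pnorm_ge: "P \<in> prods S n \<Longrightarrow> P $ i $ j \<le> pnorm S n i j"
  unfolding pnorm_def using prods_finite by (intro Max_ge) auto

lemma pnorm_obtain: obtains P where "P \<in> prods S n" "pnorm S n i j = P $ i $ j"
proof -
  have "pnorm S n i j \<in> (\<lambda>P. P $ i $ j) ` prods S n"
    unfolding pnorm_def using prods_finite prods_nonempty by (intro Max_in) auto
  then show ?thesis using that by auto
qed

lemma pnorm_nonneg: "0 \<le> pnorm S n i j"
  by (metis pnorm_obtain prods_nonneg)

lemma pnorm_0: "pnorm S 0 i j = (if i = j then 1 else 0)"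
  unfolding pnorm_def prods_0 by (simp add: mat_def)

lemma pnorm_add_ge_mult: "pnorm S a j l * pnorm S b l k \<le> pnorm S (a + b) j k"
proof -
  obtain P where P: "P \<in> prods S a" "pnorm S a j l = P $ j $ l" by (rule pnorm_obtain)
  obtain Q where Q: "Q \<in> prods S b" "pnorm S b l k = Q $ l $ k" by (rule pnorm_obtain)
  have "P $ j $ l * Q $ l $ k \<le> (\<Sum>m\<in>UNIV. P $ j $ m * Q $ m $ k)"
    by (rule member_le_sum) (auto intro!: mult_nonneg_nonneg prods_nonneg P Q)
  also have "\<dots> = (P ** Q) $ j $ k" by (simp add: matrix_matrix_mult_def)
  also have "\<dots> \<le> pnorm S (a + b) j k" by (intro pnorm_ge prods_add P Q)
  finally show ?thesis using P Q by simp
qed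

lemma pnorm_add_le_sum: "pnorm S (a + b) j k \<le> (\<Sum>l\<in>UNIV. pnorm S a j l * pnorm S b l k)"
proof -
  obtain X where X: "X \<in> prods S (a + b)" "pnorm S (a + b) j k = X $ j $ k" by (rule pnorm_obtain)
  obtain P Q where PQ: "P \<in> prods S a" "Q \<in> prods S b" "X = P ** Q"
    using X(1) by (rule prods_add_split)
  have "X $ j $ k = (\<Sum>l\<in>UNIV. P $ j $ l * Q $ l $ k)" by (simp add: PQ matrix_matrix_mult_def)
  also have "\<dots> \<le> (\<Sum>l\<in>UNIV. pnorm S a j l * pnorm S b l k)"
    by (intro sum_mono mult_mono pnorm_ge PQ pnorm_nonneg prods_nonneg[OF PQ(2)])
  finally show ?thesis using X by simp
qed

lemma entry_max_ge: "pnorm S n j k \<le> entry_max S n"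
  unfolding entry_max_def by (rule Max_ge) (auto intro: image_eqI[of _ _ "(j, k)"])

lemma entry_max_obtain: obtains j k where "entry_max S n = pnorm S n j k"
proof -
  have "entry_max S n \<in> range (\<lambda>(j, k). pnorm S n j k)"
    unfolding entry_max_def by (rule Max_in) auto
  then show ?thesis using that by auto
qed

lemma entry_max_nonneg: "0 \<le> entry_max S n"
  by (metis entry_max_obtain pnorm_nonneg)

lemma entry_max_le_scaled: "entry_max S n \<le> real CARD('n) * entry_max S n"
  using entry_max_nonneg[of n] by (simp add: mult_le_cancel_right1)

lemma entry_max_add_le: "entry_max S (a + b) \<le> real CARD('n) * entry_max S a * entry_max S b"
proof -
  obtain j k where "entry_max S (a + b) = pnorm S (a + b) j k" by (rule entry_max_obtain)
  also have "\<dots> \<le> (\<Sum>l\<in>UNIV. pnorm S a j l * pnorm S b l k)" by (rule pnorm_add_le_sum)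
  also have "\<dots> \<le> (\<Sum>l\<in>(UNIV::'n set). entry_max S a * entry_max S b)"
    by (intro sum_mono mult_mono entry_max_ge entry_max_nonneg pnorm_nonneg)
  finally show ?thesis by simp
qed

section \<open>The joint spectral radius as a growth rate\<close>

sublocale scaled_entry_max: submultiplicative_seq "\<lambda>n. real CARD('n) * entry_max S n"
proof
  fix a b :: nat
  have "real CARD('n) * entry_max S (a + b)
      \<le> real CARD('n) * (real CARD('n) * entry_max S a * entry_max S b)"
    by (intro mult_left_mono entry_max_add_le) auto
  then show "real CARD('n) * entry_max S (a + b)
      \<le> real CARD('n) * entry_max S a * (real CARD('n) * entry_max S b)"
    by (simp add: algebra_simps)
qed (simp add: entry_max_nonneg)

lemma entry_max_le_Max_norm: "entry_max S n \<le> Max (norm ` prods S n)"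
proof -
  obtain j k where jk: "entry_max S n = pnorm S n j k" by (rule entry_max_obtain)
  obtain P where P: "P \<in> prods S n" "pnorm S n j k = P $ j $ k" by (rule pnorm_obtain)
  have "P $ j $ k \<le> norm (P $ j)" using component_le_norm_cart[of "P $ j" k] by simp
  also have "\<dots> \<le> norm P" unfolding norm_vec_def[of P] by (rule member_le_L2_set) simp_all
  also have "\<dots> \<le> Max (norm ` prods S n)" using P prods_finite by (intro Max_ge) auto
  finally show ?thesis using jk P by simp
qed

lemma Max_norm_le_entry_max:
  "Max (norm ` prods S n) \<le> real CARD('n) * (real CARD('n) * entry_max S n)"
proof -
  have "Max (norm ` prods S n) \<in> norm ` prods S n"
    using prods_finite prods_nonempty by (intro Max_in) auto
  then obtain Q where Q: "Q \<in> prods S n" "Max (norm ` prods S n) = norm Q" by auto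
  have row: "norm (Q $ i) \<le> real CARD('n) * entry_max S n" for i
  proof -
    have "norm (Q $ i) \<le> (\<Sum>j\<in>UNIV. \<bar>Q $ i $ j\<bar>)" by (rule norm_le_l1_cart)
    also have "\<dots> \<le> (\<Sum>j\<in>(UNIV::'n set). entry_max S n)"
      using Q prods_nonneg by (intro sum_mono) (auto intro: order_trans[OF pnorm_ge entry_max_ge])
    finally show ?thesis by simp
  qed
  have "norm Q \<le> (\<Sum>i\<in>UNIV. \<bar>norm (Q $ i)\<bar>)" unfolding norm_vec_def by (simp add: L2_set_le_sum)
  also have "\<dots> \<le> (\<Sum>i\<in>(UNIV::'n set). real CARD('n) * entry_max S n)"
    using row by (intro sum_mono) simp
  finally show ?thesis using Q by simp
qed

lemma jsr_eq_growth_rate: "jsr S = scaled_entry_max.growth_rate"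
proof -
  have "(\<lambda>n. root n (Max (norm ` prods S n))) \<longlonglongrightarrow> scaled_entry_max.growth_rate"
    by (rule root_tendsto_squeeze[OF scaled_entry_max.root_tendsto_growth_rate, of "1 / real CARD('n)"
          "real CARD('n)"]) (use entry_max_le_Max_norm Max_norm_le_entry_max in auto)
  then show ?thesis unfolding jsr_def by (rule limI)
qed

lemma jsr_nonneg: "0 \<le> jsr S"
  using scaled_entry_max.growth_rate_nonneg by (simp add: jsr_eq_growth_rate)

lemma jsr_pow_le: "0 < n \<Longrightarrow> jsr S ^ n \<le> real CARD('n) * entry_max S n"
  using scaled_entry_max.growth_rate_pow_le by (simp add: jsr_eq_growth_rate)

lemma root_tendsto_jsr: "(\<lambda>n. root n (real CARD('n) * entry_max S n)) \<longlonglongrightarrow> jsr S"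
  using scaled_entry_max.root_tendsto_growth_rate by (simp add: jsr_eq_growth_rate)

lemma entry_max_exp_bound:
  assumes "jsr S < y" obtains C where "0 < C" "\<And>n. entry_max S n \<le> C * y ^ n"
proof -
  obtain C where C: "0 < C" "\<And>n. real CARD('n) * entry_max S n \<le> C * y ^ n"
    using scaled_entry_max.exp_bound_above_growth_rate assms by (auto simp: jsr_eq_growth_rate)
  then show ?thesis using that[OF C(1)] entry_max_le_scaled order_trans by meson
qed

lemma pnorm_diag_pow_le: "pnorm S n i i ^ k \<le> pnorm S (n * k) i i"
proof (induction k)
  case (Suc k)
  have "pnorm S n i i ^ Suc k \<le> pnorm S n i i * pnorm S (n * k) i i"
    using Suc pnorm_nonneg by (simp add: mult_left_mono)
  also have "\<dots> \<le> pnorm S (n + n * k) i i" by (rule pnorm_add_ge_mult)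
  finally show ?case by simp
qed (simp add: pnorm_0)

lemma root_diag_le_jsr:
  assumes "0 < m" shows "root m (pnorm S m i i) \<le> jsr S"
proof -
  let ?c = "pnorm S m i i" and ?f = "\<lambda>n. root n (real CARD('n) * entry_max S n)"
  have "strict_mono (\<lambda>k. m * Suc k)" using assms by (intro strict_monoI) auto
  then have lim: "(?f \<circ> (\<lambda>k. m * Suc k)) \<longlonglongrightarrow> jsr S"
    by (rule LIMSEQ_subseq_LIMSEQ[OF root_tendsto_jsr])
  have "root m ?c \<le> ?f (m * Suc k)" for k
  proof -
    have "root m ?c = root m (root (Suc k) (?c ^ Suc k))"
      by (subst real_root_power_cancel) (auto simp: pnorm_nonneg)
    also have "\<dots> = root (m * Suc k) (?c ^ Suc k)" by (rule real_root_mult_exp[symmetric])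
    also have "\<dots> \<le> ?f (m * Suc k)"
    proof (rule real_root_le_mono)
      have "?c ^ Suc k \<le> entry_max S (m * Suc k)"
        using pnorm_diag_pow_le entry_max_ge order_trans by blast
      also have "\<dots> \<le> real CARD('n) * entry_max S (m * Suc k)"
        by (rule entry_max_le_scaled)
      finally show "?c ^ Suc k \<le> real CARD('n) * entry_max S (m * Suc k)" .
    qed (use assms in simp)
    finally show ?thesis .
  qed
  then show ?thesis by (intro LIMSEQ_le_const[OF lim]) auto
qed

lemma Max_root_diag_le_jsr:
  assumes "\<And>i. 0 < m i"
  shows "Max (range (\<lambda>i. root (m i) (pnorm S (m i) i i))) \<le> jsr S"
  by (intro Max.boundedI) (auto simp: assms root_diag_le_jsr)

section \<open>A diagonal entry of maximal growth\<close>

lemma root_diag_le_diag_rate: "0 < n \<Longrightarrow> root n (pnorm S n i i) \<le> diag_rate S i"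
  unfolding diag_rate_def
  by (rule cSup_upper) (auto intro!: bdd_aboveI[of _ "jsr S"] root_diag_le_jsr)

lemma diag_rate_nonneg: "0 \<le> diag_rate S i"
  using root_diag_le_diag_rate[of 1 i] pnorm_nonneg[of 1 i i] by simp

lemma pnorm_diag_le_diag_rate_pow: "pnorm S n i i \<le> diag_rate S i ^ n"
proof (cases "n = 0")
  case False
  then have "pnorm S n i i = root n (pnorm S n i i) ^ n"
    using pnorm_nonneg by simp
  also have "\<dots> \<le> diag_rate S i ^ n"
    using False pnorm_nonneg by (intro power_mono root_diag_le_diag_rate) auto
  finally show ?thesis .
qed (simp add: pnorm_0)

lemma pnorm_le_path_prod:
  "\<exists>l::nat \<Rightarrow> 'n. l 0 = j \<and> l (Suc t) = k \<and>
     pnorm S (Suc t * N) j k \<le> real CARD('n) ^ Suc t * (\<Prod>r<Suc t. pnorm S N (l r) (l (Suc r)))"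
proof (induction t arbitrary: j)
  case 0
  have "pnorm S N j k \<le> real CARD('n) * pnorm S N j k"
    using pnorm_nonneg[of N j k] by (simp add: mult_le_cancel_right1)
  then show ?case by (intro exI[of _ "\<lambda>r. if r = 0 then j else k"]) simp
next
  case (Suc t)
  let ?g = "\<lambda>m. pnorm S N j m * pnorm S (Suc t * N) m k"
  obtain m0 where m0: "\<And>m. ?g m \<le> ?g m0"
    using Max_in[of "range ?g"] Max_ge[of "range ?g"] by fastforce
  obtain l where l: "l 0 = m0" "l (Suc t) = k"
    "pnorm S (Suc t * N) m0 k \<le> real CARD('n) ^ Suc t * (\<Prod>r<Suc t. pnorm S N (l r) (l (Suc r)))"
    using Suc by blast
  define l' where "l' r = (if r = 0 then j else l (r - 1))" for r
  have "pnorm S (Suc (Suc t) * N) j k = pnorm S (N + Suc t * N) j k" by (simp add: algebra_simps)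
  also have "\<dots> \<le> (\<Sum>m\<in>UNIV. ?g m)" by (rule pnorm_add_le_sum)
  also have "\<dots> \<le> real CARD('n) * ?g m0"
    using sum_bounded_above[of UNIV ?g "?g m0"] m0 by simp
  also have "\<dots> \<le> real CARD('n) * (pnorm S N j m0 *
      (real CARD('n) ^ Suc t * (\<Prod>r<Suc t. pnorm S N (l r) (l (Suc r)))))"
    using l(3) pnorm_nonneg by (intro mult_left_mono) auto
  also have "\<dots> = real CARD('n) ^ Suc (Suc t) * (\<Prod>r<Suc (Suc t). pnorm S N (l' r) (l' (Suc r)))"
    unfolding prod.lessThan_Suc_shift[of _ "Suc t"] by (simp add: l'_def l(1) mult_ac)
  finally show ?case using l(2) by (intro exI[of _ l']) (simp add: l'_def)
qed

lemma path_prod_le_pnorm: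
  "(\<Prod>r\<in>{s..<s + q}. pnorm S N (l r) (l (Suc r))) \<le> pnorm S (q * N) (l s) (l (s + q))"
proof (induction q)
  case (Suc q)
  have "(\<Prod>r\<in>{s..<s + Suc q}. pnorm S N (l r) (l (Suc r))) =
      (\<Prod>r\<in>{s..<s + q}. pnorm S N (l r) (l (Suc r))) * pnorm S N (l (s + q)) (l (Suc (s + q)))"
    by (simp add: prod.atLeastLessThan_Suc)
  also have "\<dots> \<le> pnorm S (q * N) (l s) (l (s + q)) * pnorm S N (l (s + q)) (l (Suc (s + q)))"
    using Suc pnorm_nonneg by (intro mult_right_mono) auto
  also have "\<dots> \<le> pnorm S (q * N + N) (l s) (l (Suc (s + q)))" by (rule pnorm_add_ge_mult)
  finally show ?case by (simp add: algebra_simps)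
qed (simp add: pnorm_0)

lemma diag_rate_le_Max: "diag_rate S i \<le> Max (range (diag_rate S))"
  by (rule Max_ge) auto

text \<open>Two of the first \<open>d + 1\<close> indices of the chain coincide, and the factors between them
  form a cycle.\<close>
lemma path_prod_le_cycle_bound:
  fixes l :: "nat \<Rightarrow> 'n"
  obtains q where "1 \<le> q" "q \<le> CARD('n)"
    "(\<Prod>r<Suc CARD('n). pnorm S N (l r) (l (Suc r)))
       \<le> entry_max S N ^ (Suc CARD('n) - q) * Max (range (diag_rate S)) ^ (q * N)"
proof -
  let ?d = "CARD('n)" and ?R = "Max (range (diag_rate S))"
  let ?w = "\<lambda>r. pnorm S N (l r) (l (Suc r))"
  have "\<not> inj_on l {..<Suc ?d}"
    using card_inj_on_le[of l "{..<Suc ?d}" UNIV] by auto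
  then obtain s u where su: "s < u" "u \<le> ?d" "l s = l u"
    unfolding inj_on_def by (metis lessThan_iff less_Suc_eq_le linorder_neqE_nat)
  define q where "q = u - s"
  have q: "1 \<le> q" "q \<le> ?d" "u = s + q" using su unfolding q_def by auto
  define A where "A = {..<s} \<union> {u..<Suc ?d}"
  have "card A = Suc ?d - q"
    unfolding A_def using su q by (subst card_Un_disjoint) auto
  have "(\<Prod>r\<in>A. ?w r) \<le> (\<Prod>r\<in>A. entry_max S N)"
    by (intro prod_mono) (simp add: pnorm_nonneg entry_max_ge)
  also have "\<dots> = entry_max S N ^ (Suc ?d - q)"
    using \<open>card A = Suc ?d - q\<close> by simp
  finally have outside: "(\<Prod>r\<in>A. ?w r) \<le> entry_max S N ^ (Suc ?d - q)" .
  have "(\<Prod>r\<in>{s..<u}. ?w r) \<le> pnorm S (q * N) (l s) (l s)"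
    using path_prod_le_pnorm[where s=s and q=q and N=N and l=l] su q by simp
  also have "\<dots> \<le> diag_rate S (l s) ^ (q * N)" by (rule pnorm_diag_le_diag_rate_pow)
  also have "\<dots> \<le> ?R ^ (q * N)" using diag_rate_nonneg by (intro power_mono diag_rate_le_Max)
  finally have cycle: "(\<Prod>r\<in>{s..<u}. ?w r) \<le> ?R ^ (q * N)" .
  have split: "{..<Suc ?d} = A \<union> {s..<u}" "A \<inter> {s..<u} = {}" unfolding A_def using su by auto
  have "(\<Prod>r<Suc ?d. ?w r) = (\<Prod>r\<in>A. ?w r) * (\<Prod>r\<in>{s..<u}. ?w r)"
    unfolding split(1) by (rule prod.union_disjoint) (use split(2) A_def in auto)
  also have "\<dots> \<le> entry_max S N ^ (Suc ?d - q) * ?R ^ (q * N)"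
    using outside cycle by (intro mult_mono) (auto intro: prod_nonneg pnorm_nonneg simp: entry_max_nonneg)
  finally show ?thesis using that q(1,2) by blast
qed

lemma jsr_pow_le_cycle_bound:
  assumes "0 < N"
  obtains q where "1 \<le> q" "q \<le> CARD('n)"
    "jsr S ^ (Suc CARD('n) * N) \<le> real CARD('n) ^ Suc (Suc CARD('n))
       * (entry_max S N ^ (Suc CARD('n) - q) * Max (range (diag_rate S)) ^ (q * N))"
proof -
  let ?d = "CARD('n)"
  obtain j k where jk: "entry_max S (Suc ?d * N) = pnorm S (Suc ?d * N) j k"
    by (rule entry_max_obtain)
  obtain l :: "nat \<Rightarrow> 'n" where l: "l 0 = j" "l (Suc ?d) = k"
    "pnorm S (Suc ?d * N) j k \<le> real ?d ^ Suc ?d * (\<Prod>r<Suc ?d. pnorm S N (l r) (l (Suc r)))"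
    using pnorm_le_path_prod by blast
  obtain q where q: "1 \<le> q" "q \<le> ?d" "(\<Prod>r<Suc ?d. pnorm S N (l r) (l (Suc r)))
      \<le> entry_max S N ^ (Suc ?d - q) * Max (range (diag_rate S)) ^ (q * N)"
    by (rule path_prod_le_cycle_bound)
  have "jsr S ^ (Suc ?d * N) \<le> real ?d * pnorm S (Suc ?d * N) j k"
    using jsr_pow_le[of "Suc ?d * N"] assms jk by simp
  also have "\<dots> \<le> real ?d * (real ?d ^ Suc ?d
      * (entry_max S N ^ (Suc ?d - q) * Max (range (diag_rate S)) ^ (q * N)))"
    using l(3) q(3) by (intro mult_left_mono order_trans[OF l(3)]) auto
  finally show ?thesis using that q(1,2) by (simp add: mult.assoc)
qed

lemma jsr_pow_le_geometric:
  assumes "jsr S < y" and R_le: "Max (range (diag_rate S)) \<le> y"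
  obtains D where "\<And>N. 0 < N \<Longrightarrow>
    (jsr S ^ Suc CARD('n)) ^ N \<le> D * (y ^ CARD('n) * Max (range (diag_rate S))) ^ N"
proof -
  let ?d = "CARD('n)" and ?R = "Max (range (diag_rate S))"
  have "0 \<le> y" using jsr_nonneg assms(1) by linarith
  have "0 \<le> ?R" by (rule order_trans[OF diag_rate_nonneg diag_rate_le_Max])
  obtain C where C: "0 < C" "\<And>n. entry_max S n \<le> C * y ^ n"
    using entry_max_exp_bound[OF assms(1)] by blast
  define C' where "C' = max 1 C"
  have "C \<le> C'" "1 \<le> C'" unfolding C'_def by simp_all
  have "(jsr S ^ Suc ?d) ^ N \<le> (real ?d ^ Suc (Suc ?d) * C' ^ Suc ?d) * (y ^ ?d * ?R) ^ N"
    if N: "0 < N" for N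
  proof -
    obtain q where q: "1 \<le> q" "q \<le> ?d" "jsr S ^ (Suc ?d * N)
        \<le> real ?d ^ Suc (Suc ?d) * (entry_max S N ^ (Suc ?d - q) * ?R ^ (q * N))"
      using jsr_pow_le_cycle_bound[OF N] by blast
    have "entry_max S N \<le> C' * y ^ N"
      using C(2)[of N] mult_right_mono[OF \<open>C \<le> C'\<close> zero_le_power[OF \<open>0 \<le> y\<close>]] by (rule order_trans)
    then have "entry_max S N ^ (Suc ?d - q) * ?R ^ (q * N) \<le> C' ^ Suc ?d * (y ^ ?d * ?R) ^ N"
      by (rule pow_mult_pow_le_geometric[OF q(1,2) \<open>0 \<le> ?R\<close> R_le entry_max_nonneg _ \<open>1 \<le> C'\<close>])
    then have "jsr S ^ (Suc ?d * N) \<le> real ?d ^ Suc (Suc ?d) * (C' ^ Suc ?d * (y ^ ?d * ?R) ^ N)"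
      by (rule order_trans[OF q(3) mult_left_mono]) simp
    then show ?thesis by (simp only: power_mult[symmetric] mult.assoc)
  qed
  then show ?thesis using that by blast
qed

lemma jsr_le_Max_diag_rate: "jsr S \<le> Max (range (diag_rate S))"
proof (rule ccontr)
  let ?d = "CARD('n)" and ?R = "Max (range (diag_rate S))"
  assume "\<not> jsr S \<le> ?R"
  then have "?R < jsr S" by (simp only: not_le)
  have "0 \<le> ?R" by (rule order_trans[OF diag_rate_nonneg diag_rate_le_Max])
  have bound: "jsr S ^ Suc ?d \<le> y ^ ?d * ?R" if y: "jsr S < y" for y
  proof -
    have "0 \<le> y" using jsr_nonneg y by linarith
    obtain D where D: "\<And>N. 0 < N \<Longrightarrow> (jsr S ^ Suc ?d) ^ N \<le> D * (y ^ ?d * ?R) ^ N"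
      using jsr_pow_le_geometric[OF y] \<open>?R < jsr S\<close> y by (meson less_imp_le less_trans)
    show ?thesis
      by (rule le_if_pow_le_const_mult_pow[OF _ D]) (use \<open>0 \<le> y\<close> \<open>0 \<le> ?R\<close> in simp)
  qed
  have "((\<lambda>y. y ^ ?d * ?R) \<longlongrightarrow> jsr S ^ ?d * ?R) (at_right (jsr S))"
    by (intro tendsto_intros)
  moreover have "\<forall>\<^sub>F y in at_right (jsr S). jsr S ^ Suc ?d \<le> y ^ ?d * ?R"
    using eventually_at_right_less by (rule eventually_mono) (rule bound)
  ultimately have "jsr S ^ Suc ?d \<le> jsr S ^ ?d * ?R"
    by (rule tendsto_lowerbound) simp
  moreover have "jsr S ^ ?d * ?R < jsr S ^ ?d * jsr S"
    using \<open>?R < jsr S\<close> \<open>0 \<le> ?R\<close> by (intro mult_strict_left_mono zero_less_power) linarith+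
  ultimately show False by (simp add: mult.commute)
qed

section \<open>Return times\<close>

lemma reaches_refl: "reaches S j j"
  unfolding reaches_def by (intro exI[of _ 0]) (simp add: pnorm_0)

lemma reaches_trans: "reaches S j l \<Longrightarrow> reaches S l k \<Longrightarrow> reaches S j k"
  unfolding reaches_def
  by (metis mult_pos_pos order_less_le_trans pnorm_add_ge_mult zero_less_mult_iff)

lemma mem_scc_self: "i \<in> scc S i"
  unfolding scc_def using reaches_refl by simp

text \<open>Paths that leave the strongly connected class of \<open>i\<close> cannot come back to it.\<close>
lemma pnorm_add_le_sum_scc:
  assumes "j \<in> scc S i" "k \<in> scc S i"
  shows "pnorm S (a + b) j k \<le> (\<Sum>l\<in>scc S i. pnorm S a j l * pnorm S b l k)"
proof -
  have "pnorm S a j l * pnorm S b l k = 0" if "l \<notin> scc S i" for l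
  proof (rule ccontr)
    assume "pnorm S a j l * pnorm S b l k \<noteq> 0"
    then have "reaches S j l" "reaches S l k"
      unfolding reaches_def using pnorm_nonneg[of a j l] pnorm_nonneg[of b l k]
      by (metis less_eq_real_def mult_eq_0_iff)+
    then have "l \<in> scc S i"
      using assms unfolding scc_def by (blast intro: reaches_trans)
    then show False using that by simp
  qed
  then have "(\<Sum>l\<in>UNIV. pnorm S a j l * pnorm S b l k) = (\<Sum>l\<in>scc S i. pnorm S a j l * pnorm S b l k)"
    by (intro sum.mono_neutral_right) auto
  then show ?thesis using pnorm_add_le_sum by metis
qed

lemma scc_entry_max_ge: "j \<in> scc S i \<Longrightarrow> k \<in> scc S i \<Longrightarrow> pnorm S n j k \<le> scc_entry_max S i n"
  unfolding scc_entry_max_def by (rule Max_ge) (auto intro: image_eqI[of _ _ "(j, k)"])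

lemma scc_entry_max_obtain:
  obtains j k where "j \<in> scc S i" "k \<in> scc S i" "scc_entry_max S i n = pnorm S n j k"
proof -
  have "scc_entry_max S i n \<in> (\<lambda>(j, k). pnorm S n j k) ` (scc S i \<times> scc S i)"
    unfolding scc_entry_max_def using mem_scc_self by (intro Max_in) auto
  then show ?thesis using that by auto
qed

lemma scc_entry_max_nonneg: "0 \<le> scc_entry_max S i n"
  using scc_entry_max_ge[OF mem_scc_self mem_scc_self] pnorm_nonneg order_trans by blast

lemma pnorm_le_scc_entry_max_pow:
  assumes "j \<in> scc S i" "k \<in> scc S i"
  shows "pnorm S (Suc t * N) j k \<le> real CARD('n) ^ t * scc_entry_max S i N ^ Suc t"
  using assms(1)
proof (induction t arbitrary: j)
  case 0
  then show ?case using scc_entry_max_ge[OF _ assms(2)] by simp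
next
  case (Suc t)
  let ?M = "scc_entry_max S i N"
  have "pnorm S (Suc (Suc t) * N) j k = pnorm S (N + Suc t * N) j k" by (simp add: algebra_simps)
  also have "\<dots> \<le> (\<Sum>l\<in>scc S i. pnorm S N j l * pnorm S (Suc t * N) l k)"
    by (rule pnorm_add_le_sum_scc[OF Suc.prems assms(2)])
  also have "\<dots> \<le> (\<Sum>l\<in>scc S i. ?M * (real CARD('n) ^ t * ?M ^ Suc t))"
    using Suc.IH scc_entry_max_ge[OF Suc.prems] pnorm_nonneg scc_entry_max_nonneg
    by (intro sum_mono mult_mono) auto
  also have "\<dots> \<le> real CARD('n) * (?M * (real CARD('n) ^ t * ?M ^ Suc t))"
    using scc_entry_max_nonneg card_mono[of UNIV "scc S i"] by (simp add: mult_right_mono)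
  finally show ?case by (simp add: mult_ac)
qed

lemma diag_rate_pow_le_scc_entry_max:
  assumes "0 < N" shows "diag_rate S i ^ N \<le> real CARD('n) * scc_entry_max S i N"
proof -
  let ?X = "real CARD('n) * scc_entry_max S i N"
  have "0 \<le> ?X" using scc_entry_max_nonneg by simp
  have "root n (pnorm S n i i) \<le> root N ?X" if "0 < n" for n
  proof -
    have "pnorm S n i i ^ N \<le> pnorm S (Suc (n - 1) * N) i i"
      using pnorm_diag_pow_le[of n i N] that by simp
    also have "\<dots> \<le> real CARD('n) ^ (n - 1) * scc_entry_max S i N ^ Suc (n - 1)"
      by (rule pnorm_le_scc_entry_max_pow[OF mem_scc_self mem_scc_self])
    also have "\<dots> \<le> ?X ^ n"
      unfolding power_mult_distrib Suc_diff_1[OF that] using scc_entry_max_nonneg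
      by (intro mult_right_mono power_increasing) auto
    finally show ?thesis by (rule root_le_root_if_pow_le[OF that assms pnorm_nonneg \<open>0 \<le> ?X\<close>])
  qed
  then have "diag_rate S i \<le> root N ?X"
    unfolding diag_rate_def by (intro cSup_least) blast+
  then have "diag_rate S i ^ N \<le> root N ?X ^ N" using diag_rate_nonneg by (intro power_mono) auto
  then show ?thesis using assms \<open>0 \<le> ?X\<close> by simp
qed

lemma return_times_add:
  "m \<in> return_times S i \<Longrightarrow> n \<in> return_times S i \<Longrightarrow> m + n \<in> return_times S i"
  unfolding return_times_def
  by (auto intro: order_less_le_trans[OF mult_pos_pos pnorm_add_ge_mult])

lemma return_times_nonempty:
  assumes "0 < diag_rate S i" shows "return_times S i \<noteq> {}"
proof
  assume none: "return_times S i = {}"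
  have "root n (pnorm S n i i) \<le> 0" if "0 < n" for n
  proof -
    have "\<not> 0 < pnorm S n i i" using none that unfolding return_times_def by blast
    then show ?thesis using pnorm_nonneg[of n i i] by simp
  qed
  then have "diag_rate S i \<le> 0" unfolding diag_rate_def by (intro cSup_least) auto
  then show False using assms by simp
qed

lemma return_times_pnorm_lower_bound:
  obtains c where "0 < c" "\<And>n. n \<in> return_times S i \<Longrightarrow> n \<le> X \<Longrightarrow> c \<le> pnorm S n i i"
proof -
  have "finite {n \<in> return_times S i. n \<le> X}" by (rule finite_subset[of _ "{..X}"]) auto
  then show ?thesis
    using finite_pos_lower_bound[of _ "\<lambda>n. pnorm S n i i"] that
    unfolding return_times_def by (metis (mono_tags, lifting) mem_Collect_eq)
qed

lemma scc_heavy_entry: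
  assumes "jsr S \<le> diag_rate S i" "0 < N"
  obtains j k where "j \<in> scc S i" "k \<in> scc S i" "jsr S ^ N \<le> real CARD('n) * pnorm S N j k"
proof -
  obtain j k where jk: "j \<in> scc S i" "k \<in> scc S i" "scc_entry_max S i N = pnorm S N j k"
    by (rule scc_entry_max_obtain)
  have "jsr S ^ N \<le> diag_rate S i ^ N" using assms jsr_nonneg by (intro power_mono) auto
  also have "\<dots> \<le> real CARD('n) * scc_entry_max S i N"
    by (rule diag_rate_pow_le_scc_entry_max[OF assms(2)])
  finally show ?thesis using that jk by simp
qed

lemma scc_detour:
  obtains c B where "0 < c" "\<And>N j k. j \<in> scc S i \<Longrightarrow> k \<in> scc S i \<Longrightarrow>
    \<exists>s. N \<le> s \<and> s \<le> N + B \<and> c * pnorm S N j k \<le> pnorm S s i i"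
proof -
  have "\<forall>j\<in>scc S i. \<exists>a. 0 < pnorm S a i j" "\<forall>j\<in>scc S i. \<exists>b. 0 < pnorm S b j i"
    unfolding scc_def reaches_def by blast+
  then obtain a b where a: "\<And>j. j \<in> scc S i \<Longrightarrow> 0 < pnorm S (a j) i j"
    and b: "\<And>j. j \<in> scc S i \<Longrightarrow> 0 < pnorm S (b j) j i"
    by metis
  obtain c where c: "0 < c"
    "\<And>p. p \<in> scc S i \<times> scc S i \<Longrightarrow> c \<le> pnorm S (a (fst p)) i (fst p) * pnorm S (b (snd p)) (snd p) i"
    by (rule finite_pos_lower_bound[of "scc S i \<times> scc S i"
          "\<lambda>p. pnorm S (a (fst p)) i (fst p) * pnorm S (b (snd p)) (snd p) i"])
      (auto intro!: mult_pos_pos a b)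
  define B where "B = Max (a ` scc S i) + Max (b ` scc S i)"
  show ?thesis
  proof (rule that[OF c(1)])
    fix N j k assume jk: "j \<in> scc S i" "k \<in> scc S i"
    have "a j + b k \<le> B" unfolding B_def using jk by (intro add_mono Max_ge) auto
    have "c * pnorm S N j k \<le> pnorm S (a j) i j * pnorm S (b k) k i * pnorm S N j k"
      using c(2)[of "(j, k)"] jk pnorm_nonneg by (intro mult_right_mono) auto
    also have "\<dots> = pnorm S (a j) i j * pnorm S N j k * pnorm S (b k) k i" by (simp only: mult_ac)
    also have "\<dots> \<le> pnorm S (a j + N) i k * pnorm S (b k) k i"
      using pnorm_nonneg by (intro mult_right_mono pnorm_add_ge_mult)
    also have "\<dots> \<le> pnorm S (a j + N + b k) i i" by (rule pnorm_add_ge_mult)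
    finally show "\<exists>s. N \<le> s \<and> s \<le> N + B \<and> c * pnorm S N j k \<le> pnorm S s i i"
      using \<open>a j + b k \<le> B\<close> by (intro exI[of _ "a j + N + b k"]) auto
  qed
qed

lemma heavy_return_near:
  assumes "0 < jsr S" "jsr S \<le> diag_rate S i"
  obtains c B where "0 < c" "\<And>N. 0 < N \<Longrightarrow>
    \<exists>s\<in>return_times S i. N \<le> s \<and> s \<le> N + B \<and> c * jsr S ^ N \<le> pnorm S s i i"
proof -
  let ?d = "real CARD('n)"
  obtain c B where c: "0 < c" "\<And>N j k. j \<in> scc S i \<Longrightarrow> k \<in> scc S i \<Longrightarrow>
      \<exists>s. N \<le> s \<and> s \<le> N + B \<and> c * pnorm S N j k \<le> pnorm S s i i"
    using scc_detour[of i] by blast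
  show ?thesis
  proof (rule that[of "c / ?d" B])
    show "0 < c / ?d" using c(1) by simp
    fix N :: nat assume "0 < N"
    obtain j k where jk: "j \<in> scc S i" "k \<in> scc S i" "jsr S ^ N \<le> ?d * pnorm S N j k"
      using scc_heavy_entry[OF assms(2) \<open>0 < N\<close>] by blast
    obtain s where s: "N \<le> s" "s \<le> N + B" "c * pnorm S N j k \<le> pnorm S s i i"
      using c(2)[OF jk(1,2)] by blast
    have "c / ?d * jsr S ^ N \<le> c / ?d * (?d * pnorm S N j k)"
      using jk(3) c(1) by (intro mult_left_mono) auto
    also have "\<dots> \<le> pnorm S s i i" using s(3) by simp
    finally have "c / ?d * jsr S ^ N \<le> pnorm S s i i" .
    moreover have "0 < c / ?d * jsr S ^ N" using c(1) assms(1) by simp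
    ultimately have "s \<in> return_times S i"
      using s(1) \<open>0 < N\<close> unfolding return_times_def by simp
    then show "\<exists>s\<in>return_times S i. N \<le> s \<and> s \<le> N + B \<and> c / ?d * jsr S ^ N \<le> pnorm S s i i"
      using s(1,2) \<open>c / ?d * jsr S ^ N \<le> pnorm S s i i\<close> by blast
  qed
qed

text \<open>A heavy return of length slightly above \<open>n - X\<close> leaves a remainder that is bounded and
  divisible by the period, hence is itself a short return.\<close>
lemma pnorm_diag_ge_jsr_pow_shift:
  assumes "0 < jsr S" "jsr S \<le> diag_rate S i"
  obtains X C where "0 < C"
    "\<And>n. n \<in> return_times S i \<Longrightarrow> X < n \<Longrightarrow> C * jsr S ^ (n - X) \<le> pnorm S n i i"
proof -
  let ?T = "return_times S i"
  have "0 < diag_rate S i" using assms by linarith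
  then obtain t where "t \<in> ?T" using return_times_nonempty by blast
  obtain g F where gF: "\<And>s. s \<in> ?T \<Longrightarrow> g dvd s" "\<And>z. F \<le> z \<Longrightarrow> g dvd z \<Longrightarrow> z \<in> ?T"
    by (rule add_closed_eventually_periodic[OF return_times_add _ \<open>t \<in> ?T\<close>])
      (auto simp: return_times_def)
  obtain c B where c: "0 < c" "\<And>N. 0 < N \<Longrightarrow>
      \<exists>s\<in>?T. N \<le> s \<and> s \<le> N + B \<and> c * jsr S ^ N \<le> pnorm S s i i"
    using heavy_return_near[OF assms] by blast
  define X where "X = F + B"
  obtain c' where c': "0 < c'" "\<And>r. r \<in> ?T \<Longrightarrow> r \<le> X \<Longrightarrow> c' \<le> pnorm S r i i"
    using return_times_pnorm_lower_bound[where i = i and X = X] by blast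
  show ?thesis
  proof (rule that[of "c * c'" X])
    show "0 < c * c'" using c(1) c'(1) by simp
    fix n assume n: "n \<in> ?T" "X < n"
    obtain s where s: "s \<in> ?T" "n - X \<le> s" "s \<le> n - X + B" "c * jsr S ^ (n - X) \<le> pnorm S s i i"
      using c(2)[of "n - X"] n(2) by auto
    define r where "r = n - s"
    have "F \<le> r" "r \<le> X" "n = s + r" using n(2) s(2,3) unfolding r_def X_def by arith+
    have "g dvd r" unfolding r_def by (intro dvd_diff_nat gF(1) n(1) s(1))
    then have "r \<in> ?T" by (rule gF(2)[OF \<open>F \<le> r\<close>])
    have "c * c' * jsr S ^ (n - X) = (c * jsr S ^ (n - X)) * c'" by simp
    also have "\<dots> \<le> pnorm S s i i * pnorm S r i i"
      using s(4) c'(2)[OF \<open>r \<in> ?T\<close> \<open>r \<le> X\<close>] c'(1) pnorm_nonneg by (intro mult_mono) auto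
    also have "\<dots> \<le> pnorm S n i i" unfolding \<open>n = s + r\<close> by (rule pnorm_add_ge_mult)
    finally show "c * c' * jsr S ^ (n - X) \<le> pnorm S n i i" .
  qed
qed

lemma jsr_pow_le_const_mult_diag:
  assumes "0 < jsr S" "jsr S \<le> diag_rate S i"
  obtains K where "0 < K" "\<And>n. n \<in> return_times S i \<Longrightarrow> jsr S ^ n \<le> K * pnorm S n i i"
proof -
  obtain X C where XC: "0 < C"
    "\<And>n. n \<in> return_times S i \<Longrightarrow> X < n \<Longrightarrow> C * jsr S ^ (n - X) \<le> pnorm S n i i"
    using pnorm_diag_ge_jsr_pow_shift[OF assms] by blast
  obtain c where c: "0 < c" "\<And>n. n \<in> return_times S i \<Longrightarrow> n \<le> X \<Longrightarrow> c \<le> pnorm S n i i"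
    using return_times_pnorm_lower_bound[where i = i and X = X] by blast
  define M where "M = max 1 (jsr S) ^ X"
  have "1 \<le> M" unfolding M_def by simp
  have M: "jsr S ^ n \<le> M" if "n \<le> X" for n
    unfolding M_def using that jsr_nonneg by (intro order_trans[OF power_mono power_increasing]) auto
  show ?thesis
  proof (rule that[of "max (M / c) (M / C)"])
    show "0 < max (M / c) (M / C)" using \<open>1 \<le> M\<close> c(1) by (simp add: less_max_iff_disj)
    fix n assume n: "n \<in> return_times S i"
    show "jsr S ^ n \<le> max (M / c) (M / C) * pnorm S n i i"
    proof (cases "n \<le> X")
      case True
      have "jsr S ^ n \<le> M" by (rule M[OF True])
      also have "\<dots> \<le> M / c * pnorm S n i i"
        using c(1) c(2)[OF n True] \<open>1 \<le> M\<close> by (simp add: field_simps mult_left_mono)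
      also have "\<dots> \<le> max (M / c) (M / C) * pnorm S n i i"
        by (rule mult_right_mono[OF max.cobounded1 pnorm_nonneg])
      finally show ?thesis .
    next
      case False
      have "jsr S ^ n = jsr S ^ (n - X) * jsr S ^ X" using False by (simp flip: power_add)
      also have "\<dots> \<le> pnorm S n i i / C * M"
        using XC(2)[OF n] False XC(1) M[of X] jsr_nonneg pnorm_nonneg
        by (intro mult_mono) (auto simp: field_simps)
      also have "\<dots> = M / C * pnorm S n i i" by simp
      also have "\<dots> \<le> max (M / c) (M / C) * pnorm S n i i"
        by (rule mult_right_mono[OF max.cobounded2 pnorm_nonneg])
      finally show ?thesis .
    qed
  qed
qed

lemma jsr_dominated_by_diag:
  assumes "0 < jsr S"
  obtains i K where "0 < K" "return_times S i \<noteq> {}"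
    "\<And>n. n \<in> return_times S i \<Longrightarrow> jsr S ^ n \<le> K * pnorm S n i i"
proof -
  have "Max (range (diag_rate S)) \<in> range (diag_rate S)" by (rule Max_in) auto
  then obtain i where "Max (range (diag_rate S)) = diag_rate S i" by blast
  then have i: "jsr S \<le> diag_rate S i" using jsr_le_Max_diag_rate by simp
  then have "return_times S i \<noteq> {}" using assms by (intro return_times_nonempty) simp
  obtain K where K: "0 < K" "\<And>n. n \<in> return_times S i \<Longrightarrow> jsr S ^ n \<le> K * pnorm S n i i"
    using jsr_pow_le_const_mult_diag[OF assms i] by blast
  show ?thesis by (rule that[OF K(1) \<open>return_times S i \<noteq> {}\<close> K(2)])
qed

lemma Max_root_nonneg: "0 \<le> K \<Longrightarrow> 0 \<le> Max (range (\<lambda>i. root (m i) (K * pnorm S (m i) i i)))"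
proof -
  fix j assume "0 \<le> K"
  then have "0 \<le> root (m j) (K * pnorm S (m j) j j)"
    by (intro real_root_ge_zero mult_nonneg_nonneg pnorm_nonneg)
  also have "\<dots> \<le> Max (range (\<lambda>i. root (m i) (K * pnorm S (m i) i i)))" by (rule Max_ge) auto
  finally show ?thesis .
qed

lemma jsr_le_Max_root_diag:
  assumes m: "\<forall>i. (0 < m i \<and> pnorm S (m i) i i \<noteq> 0) \<or> (m i = 1 \<and> (\<forall>k>0. pnorm S k i i = 0))"
    and "return_times S i \<noteq> {}"
    and dominated: "\<And>n. n \<in> return_times S i \<Longrightarrow> jsr S ^ n \<le> K * pnorm S n i i"
  shows "jsr S \<le> Max (range (\<lambda>i. root (m i) (K * pnorm S (m i) i i)))"
proof -
  have "\<not> (\<forall>k>0. pnorm S k i i = 0)"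
    using \<open>return_times S i \<noteq> {}\<close> unfolding return_times_def by auto
  then have mi: "0 < m i" "pnorm S (m i) i i \<noteq> 0" using m[rule_format, of i] by auto
  then have "m i \<in> return_times S i"
    using pnorm_nonneg[of "m i" i i] unfolding return_times_def by simp
  have "jsr S = root (m i) (jsr S ^ m i)"
    using jsr_nonneg mi(1) by (simp add: real_root_power_cancel)
  also have "\<dots> \<le> root (m i) (K * pnorm S (m i) i i)"
    using dominated[OF \<open>m i \<in> return_times S i\<close>] mi(1) by (rule real_root_le_mono[rotated])
  also have "\<dots> \<le> Max (range (\<lambda>i. root (m i) (K * pnorm S (m i) i i)))" by (rule Max_ge) auto
  finally show ?thesis .
qed

end

theorem theorem2:
  fixes \<Sigma> :: "(real^'n^'n) set"
  assumes "finite \<Sigma>" and "\<Sigma> \<noteq> {}"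
    and "\<forall>A\<in>\<Sigma>. \<forall>i j. A $ i $ j \<ge> 0"
  shows "\<exists>K>0. \<forall>m :: 'n \<Rightarrow> nat.
           (\<forall>i. (m i > 0 \<and> pnorm \<Sigma> (m i) i i \<noteq> 0)
              \<or> (m i = 1 \<and> (\<forall>k>0. pnorm \<Sigma> k i i = 0))) \<longrightarrow>
           (Max (range (\<lambda>i. root (m i) (pnorm \<Sigma> (m i) i i)))) \<le> jsr \<Sigma> \<and>
           jsr \<Sigma> \<le> Max (range (\<lambda>i. root (m i) (K * pnorm \<Sigma> (m i) i i)))"
proof -
  interpret nonneg_matrix_set \<Sigma> using assms by unfold_locales auto
  obtain K where "0 < K" and upper: "\<And>m. \<forall>i. (0 < m i \<and> pnorm \<Sigma> (m i) i i \<noteq> 0)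
      \<or> (m i = 1 \<and> (\<forall>k>0. pnorm \<Sigma> k i i = 0)) \<Longrightarrow>
    jsr \<Sigma> \<le> Max (range (\<lambda>i. root (m i) (K * pnorm \<Sigma> (m i) i i)))"
  proof (cases "jsr \<Sigma> = 0")
    case True
    show ?thesis by (rule that[of 1]) (simp_all only: True Max_root_nonneg zero_le_one zero_less_one)
  next
    case False
    then have "0 < jsr \<Sigma>" using jsr_nonneg by linarith
    then obtain i K where iK: "0 < K" "return_times \<Sigma> i \<noteq> {}"
      "\<And>n. n \<in> return_times \<Sigma> i \<Longrightarrow> jsr \<Sigma> ^ n \<le> K * pnorm \<Sigma> n i i"
      by (rule jsr_dominated_by_diag) blast
    show ?thesis using jsr_le_Max_root_diag[OF _ iK(2,3)] by (rule that[OF iK(1)])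
  qed
  moreover have "Max (range (\<lambda>i. root (m i) (pnorm \<Sigma> (m i) i i))) \<le> jsr \<Sigma>"
    if "\<forall>i. (0 < m i \<and> pnorm \<Sigma> (m i) i i \<noteq> 0) \<or> (m i = 1 \<and> (\<forall>k>0. pnorm \<Sigma> k i i = 0))" for m
    using that by (intro Max_root_diag_le_jsr) auto
  ultimately show ?thesis by blast
qed

end
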